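(* Let $0<x\leq 1$, $0<y\leq 1$, and $f\in C^2([0,1]^2)$. Then $$\lim_{n\to\infty} n\left(B_{n,2}^{[2]}f(x,y)-f(x,y)\right)=\frac{x(1-x)}{2}\,\frac{\partial^2 f}{\partial x^2}(x,y)+\frac{y(1-y)}{2}\,\frac{\partial^2 f}{\partial y^2}(x,y)-\frac{1-x}{2}\,\frac{\partial f}{\partial x}(x,y)-\frac{1-y}{2}\,\frac{\partial f}{\partial y}(x,y).$$
   Context: For integers $n\ge 1$ and $0\le k\le n$ and $x\in[0,1]$, let $p_{n,k}(x)=\binom{n}{k}x^k(1-x)^{n-k}$. For $n\geq 2$ and $f\in C([0,1]^2)$, the (bivariate, tensor product) Aldaz-Kounchev-Render operator with $j=2$ is defined by $$B_{n,2}^{[2]}f(x,y)=\sum_{k=0}^{n}\sum_{l=0}^{n} f\left(\sqrt{\frac{k(k-1)}{n(n-1)}},\ \sqrt{\frac{l(l-1)}{n(n-1)}}\right)p_{n,k}(x)\,p_{n,l}(y),\qquad (x,y)\in[0,1]^2.$$ $C^2([0,1]^2)$ denotes the real-valued functions on the closed square that are twice continuously differentiable (up to the boundary, with one-sided derivatives there). *)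

theory Defs
  imports "HOL-Analysis.Analysis"
begin

abbreviation unit_square :: "(real \<times> real) set" where
  "unit_square \<equiv> {0..1} \<times> {0..1}"

text \<open>
  Partial derivatives of a function on the closed unit square.  The difference quotients only range
  over the unit interval, so the derivatives are one-sided on the boundary; they are meaningful
  only at points of the square.
\<close>

definition partial_x :: "(real \<times> real \<Rightarrow> real) \<Rightarrow> real \<times> real \<Rightarrow> real" where
  "partial_x f = (\<lambda>(x, y). vector_derivative (\<lambda>t. f (t, y)) (at x within {0..1}))"

definition partial_y :: "(real \<times> real \<Rightarrow> real) \<Rightarrow> real \<times> real \<Rightarrow> real" where
  "partial_y f = (\<lambda>(x, y). vector_derivative (\<lambda>t. f (x, t)) (at y within {0..1}))"

definition has_partials_on_square :: "(real \<times> real \<Rightarrow> real) \<Rightarrow> bool" where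
  "has_partials_on_square f \<longleftrightarrow>
     (\<forall>x\<in>{0..1}. \<forall>y\<in>{0..1}.
        (\<lambda>t. f (t, y)) differentiable (at x within {0..1}) \<and>
        (\<lambda>t. f (x, t)) differentiable (at y within {0..1}))"

text \<open>
  The class \<open>C\<^sup>k\<close> on the closed square: all partial derivatives up to order \<open>k\<close>, including the
  mixed ones in either order, exist on the square and are continuous up to the boundary.
\<close>

fun Ck_square :: "nat \<Rightarrow> (real \<times> real \<Rightarrow> real) \<Rightarrow> bool" where
  "Ck_square 0 f \<longleftrightarrow> continuous_on unit_square f"
| "Ck_square (Suc k) f \<longleftrightarrow>
     continuous_on unit_square f \<and> has_partials_on_square f \<and>
     Ck_square k (partial_x f) \<and> Ck_square k (partial_y f)"

definition AKR_node :: "nat \<Rightarrow> nat \<Rightarrow> real" where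
  "AKR_node n k = sqrt ((real k * (real k - 1)) / (real n * (real n - 1)))"

text \<open>
  The bivariate Aldaz-Kounchev-Render operator with \<open>j = 2\<close>, intended for \<open>n \<ge> 2\<close>.  The library's
  \<^const>\<open>Bernstein\<close> is the basis polynomial \<open>p\<^sub>n\<^sub>,\<^sub>k\<close>.
\<close>

definition AKR2 :: "nat \<Rightarrow> (real \<times> real \<Rightarrow> real) \<Rightarrow> real \<times> real \<Rightarrow> real" where
  "AKR2 n f = (\<lambda>(x, y).
     \<Sum>k=0..n. \<Sum>l=0..n. f (AKR_node n k, AKR_node n l) * Bernstein n k x * Bernstein n l y)"

end

theory Submission
  imports Defs "HOL-Real_Asymp.Real_Asymp"
begin

text \<open>
  The nodes differ from \<open>k/n\<close> by at most \<open>1/n\<close>, so the second and fourth central moments behave like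
  those of the classical Bernstein operator; the first one is \<open>-1/(2x)\<close> times the second because
  \<open>1\<close> and \<open>t\<^sup>2\<close> are reproduced. Taylor's formula then gives the univariate Voronovskaya limit,
  uniformly for a family depending on a parameter. With \<open>B\<^sub>x\<close>, \<open>B\<^sub>y\<close> the univariate operators in either
  variable, \<open>B\<^sub>x B\<^sub>y f - f = (B\<^sub>x f - f) + B\<^sub>x (B\<^sub>y f - f)\<close>: the first summand is the univariate case, and
  in the second the uniform limit is a continuous function to which \<open>B\<^sub>x\<close> converges pointwise. No mixed
  partial derivative ever enters.
\<close>

section \<open>Bernstein means\<close>

text \<open>Expectation of \<open>g k\<close> for a binomially distributed \<open>k\<close> with
  parameters \<open>n\<close> and \<open>x\<close>. Letting \<open>g\<close> depend on the index
  rather than on a point allows the classical nodes \<open>k / n\<close> and the shifted nodes to be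
  compared under one functional.\<close>

definition bmean :: "nat \<Rightarrow> real \<Rightarrow> (nat \<Rightarrow> real) \<Rightarrow> real" where
  "bmean n x g = (\<Sum>k\<le>n. g k * Bernstein n k x)"

lemma bmean_add: "bmean n x (\<lambda>k. g k + h k) = bmean n x g + bmean n x h"
  by (simp add: bmean_def sum.distrib algebra_simps)

lemma bmean_diff: "bmean n x (\<lambda>k. g k - h k) = bmean n x g - bmean n x h"
  by (simp add: bmean_def sum_subtractf algebra_simps)

lemma bmean_cmult: "bmean n x (\<lambda>k. c * g k) = c * bmean n x g"
  by (simp add: bmean_def sum_distrib_left mult.assoc)

lemma bmean_const: "bmean n x (\<lambda>k. c) = c"
  by (simp add: bmean_def sum_distrib_left [symmetric])

lemmas bmean_linear = bmean_add bmean_diff bmean_cmult bmean_const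

lemma bmean_mono:
  assumes "0 \<le> x" "x \<le> 1" "\<And>k. k \<le> n \<Longrightarrow> g k \<le> h k"
  shows "bmean n x g \<le> bmean n x h"
  unfolding bmean_def
  by (intro sum_mono mult_right_mono) (use assms in \<open>auto simp: Bernstein_nonneg\<close>)

lemma abs_bmean_le:
  assumes "0 \<le> x" "x \<le> 1" "\<And>k. k \<le> n \<Longrightarrow> \<bar>g k\<bar> \<le> h k"
  shows "\<bar>bmean n x g\<bar> \<le> bmean n x h"
proof (rule abs_leI)
  show "bmean n x g \<le> bmean n x h"
    using assms abs_le_D1 by (intro bmean_mono) auto
  have "bmean n x (\<lambda>k. (-1) * g k) \<le> bmean n x h"
    using assms abs_le_D2 by (intro bmean_mono) auto
  then show "- bmean n x g \<le> bmean n x h"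
    unfolding bmean_cmult by simp
qed

section \<open>Pascal recursion and central moments of the binomial distribution\<close>

lemma Bernstein_Suc_Suc:
  assumes "k \<le> n"
  shows "Bernstein (Suc n) (Suc k) x = x * Bernstein n k x + (1 - x) * Bernstein n (Suc k) x"
\<comment> \<open>For \<open>k = n\<close> the binomial coefficient of
  \<open>Bernstein n (Suc n)\<close> vanishes; for \<open>k < n\<close> the truncated difference
  \<open>n - Suc k\<close> is genuine and Pascal's rule applies.\<close>
proof (cases "k = n")
  case False
  with assms have "n - k = Suc (n - Suc k)" by simp
  then have e: "(1 - x) ^ (n - k) = (1 - x) * (1 - x) ^ (n - Suc k)" by simp
  show ?thesis
    unfolding Bernstein_def binomial_Suc_Suc diff_Suc_Suc e power_Suc of_nat_add by algebra
qed (simp add: Bernstein_def)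

text \<open>Conditioning on one further Bernoulli trial: success, with weight \<open>x\<close>,
  raises the index by one. This drives the induction for the moments.\<close>

lemma bmean_Suc:
  "bmean (Suc n) x g = x * bmean n x (\<lambda>k. g (Suc k)) + (1 - x) * bmean n x g"
proof -
  have "bmean (Suc n) x g = g 0 * Bernstein (Suc n) 0 x
      + (\<Sum>k\<le>n. g (Suc k) * Bernstein (Suc n) (Suc k) x)"
    unfolding bmean_def by (rule sum.atMost_Suc_shift)
  also have "(\<Sum>k\<le>n. g (Suc k) * Bernstein (Suc n) (Suc k) x) =
      x * bmean n x (\<lambda>k. g (Suc k)) + (1 - x) * (\<Sum>k\<le>n. g (Suc k) * Bernstein n (Suc k) x)"
    by (simp add: Bernstein_Suc_Suc bmean_def sum_distrib_left sum.distrib [symmetric] algebra_simps)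
  also have "g 0 * Bernstein (Suc n) 0 x = (1 - x) * (g 0 * Bernstein n 0 x)"
    by (simp add: Bernstein_def)
  \<comment> \<open>The shifted sum reaches the index \<open>Suc n\<close>, where the basis
    polynomial of degree \<open>n\<close> is zero, and misses only the index
    \<open>0\<close>.\<close>
  also have "(\<Sum>k\<le>n. g (Suc k) * Bernstein n (Suc k) x) = bmean n x g - g 0 * Bernstein n 0 x"
    using sum.atMost_Suc_shift [of "\<lambda>k. g k * Bernstein n k x" n]
    by (simp add: bmean_def Bernstein_def binomial_eq_0)
  finally show ?thesis by (simp add: algebra_simps)
qed

text \<open>Simultaneous induction on \<open>n\<close>: the recursion for each moment brings in all
  lower ones, which is why the third is carried along.\<close>

lemma bmean_central_moments:
  fixes x :: real
  defines "X \<equiv> x * (1 - x)"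
  shows "bmean n x (\<lambda>k. real k - real n * x) = 0"
    and "bmean n x (\<lambda>k. (real k - real n * x)\<^sup>2) = real n * X"
    and "bmean n x (\<lambda>k. (real k - real n * x) ^ 3) = real n * X * (1 - 2 * x)"
    and "bmean n x (\<lambda>k. (real k - real n * x) ^ 4) =
      real n * X * (1 - 3 * X) + 3 * real n * (real n - 1) * X\<^sup>2"
proof (induction n)
  case 0
  show "bmean 0 x (\<lambda>k. real k - real 0 * x) = 0"
    "bmean 0 x (\<lambda>k. (real k - real 0 * x)\<^sup>2) = real 0 * X"
    "bmean 0 x (\<lambda>k. (real k - real 0 * x) ^ 3) = real 0 * X * (1 - 2 * x)"
    "bmean 0 x (\<lambda>k. (real k - real 0 * x) ^ 4) =
      real 0 * X * (1 - 3 * X) + 3 * real 0 * (real 0 - 1) * X\<^sup>2"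
    by (simp_all add: bmean_def)
next
  case (Suc n)
  define d where "d k = real k - real n * x" for k
  have up: "real (Suc k) - real (Suc n) * x = d k + (1 - x)"
    and down: "real k - real (Suc n) * x = d k + (- x)" for k
    by (simp_all add: d_def algebra_simps)
  \<comment> \<open>The nesting and the placement of the coefficients match
    \<open>bmean_linear\<close>, so each expansion becomes a combination of the known
    moments.\<close>
  have p2: "(u + v)\<^sup>2 = u\<^sup>2 + ((2 * v) * u + v\<^sup>2)"
    and p3: "(u + v) ^ 3 = u ^ 3 + ((3 * v) * u\<^sup>2 + ((3 * v\<^sup>2) * u + v ^ 3))"
    and p4: "(u + v) ^ 4 = u ^ 4 + ((4 * v) * u ^ 3 + ((6 * v\<^sup>2) * u\<^sup>2 + ((4 * v ^ 3) * u + v ^ 4)))"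
    for u v :: real
    by algebra+
  have ih: "bmean n x d = 0" "bmean n x (\<lambda>k. (d k)\<^sup>2) = real n * X"
    "bmean n x (\<lambda>k. d k ^ 3) = real n * X * (1 - 2 * x)"
    "bmean n x (\<lambda>k. d k ^ 4) = real n * X * (1 - 3 * X) + 3 * real n * (real n - 1) * X\<^sup>2"
    using Suc.IH unfolding d_def [symmetric] by simp_all
  have shift: "bmean n x (\<lambda>k. d k + v) = v"
    "bmean n x (\<lambda>k. (d k + v)\<^sup>2) = real n * X + v\<^sup>2"
    "bmean n x (\<lambda>k. (d k + v) ^ 3) = real n * X * (1 - 2 * x) + 3 * v * (real n * X) + v ^ 3"
    "bmean n x (\<lambda>k. (d k + v) ^ 4) = real n * X * (1 - 3 * X) + 3 * real n * (real n - 1) * X\<^sup>2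
      + 4 * v * (real n * X * (1 - 2 * x)) + 6 * v\<^sup>2 * (real n * X) + v ^ 4" for v
    unfolding p2 p3 p4 bmean_linear ih by simp_all
  have step: "bmean (Suc n) x (\<lambda>k. P (real k - real (Suc n) * x)) =
      x * bmean n x (\<lambda>k. P (d k + (1 - x))) + (1 - x) * bmean n x (\<lambda>k. P (d k + (- x)))"
    for P :: "real \<Rightarrow> real"
    \<comment> \<open>\<open>up\<close> must be used first, since the left side of
      \<open>down\<close> also matches the term with \<open>Suc k\<close>.\<close>
    unfolding bmean_Suc up unfolding down by (rule refl)
  show "bmean (Suc n) x (\<lambda>k. real k - real (Suc n) * x) = 0"
    unfolding step [where P = "\<lambda>u. u"] shift by algebra
  show "bmean (Suc n) x (\<lambda>k. (real k - real (Suc n) * x)\<^sup>2) = real (Suc n) * X"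
    unfolding step [where P = "\<lambda>u. u\<^sup>2"] shift X_def unfolding of_nat_Suc by algebra
  show "bmean (Suc n) x (\<lambda>k. (real k - real (Suc n) * x) ^ 3) = real (Suc n) * X * (1 - 2 * x)"
    unfolding step [where P = "\<lambda>u. u ^ 3"] shift X_def unfolding of_nat_Suc by algebra
  show "bmean (Suc n) x (\<lambda>k. (real k - real (Suc n) * x) ^ 4) =
      real (Suc n) * X * (1 - 3 * X) + 3 * real (Suc n) * (real (Suc n) - 1) * X\<^sup>2"
    unfolding step [where P = "\<lambda>u. u ^ 4"] shift X_def unfolding of_nat_Suc by algebra
qed

section \<open>Nodes and moments of the operator\<close>

text \<open>With \<open>q = k / n\<close> and node \<open>a\<close>, the difference of squares has
  the closed form \<open>k (n - k) / (n^2 (n - 1))\<close>, which is nonnegative; since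
  \<open>q \<le> q + a\<close>, dividing it by \<open>q\<close> bounds \<open>q - a\<close>. For
  \<open>k = 0\<close> that division is impossible, but both points are 0.\<close>

lemma AKR_node_bounds:
  assumes "2 \<le> n" "k \<le> n"
  shows "0 \<le> real k / real n - AKR_node n k" "real k / real n - AKR_node n k \<le> 1 / real n"
proof -
  let ?q = "real k / real n" and ?a = "AKR_node n k"
  have n: "real n \<ge> 2" and k: "real k \<le> real n" using assms by auto
  have "0 \<le> ?q - ?a \<and> ?q - ?a \<le> 1 / real n"
  proof (cases "k = 0")
    case True
    then show ?thesis by (simp add: AKR_node_def)
  next
    case False
    then have k1: "real k \<ge> 1" by simp
    have a2: "?a\<^sup>2 = (real k * (real k - 1)) / (real n * (real n - 1))"
      unfolding AKR_node_def using k1 n by (intro real_sqrt_pow2) auto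
    have a0: "0 \<le> ?a" unfolding AKR_node_def using k1 n by auto
    have d: "?q\<^sup>2 - ?a\<^sup>2 = real k * (real n - real k) / ((real n)\<^sup>2 * (real n - 1))"
    proof -
      have nz: "(real n)\<^sup>2 \<noteq> 0" "real n * (real n - 1) \<noteq> 0" "(real n)\<^sup>2 * (real n - 1) \<noteq> 0"
        using n by auto
      then have nz': "(real n)\<^sup>2 * (real n * (real n - 1)) \<noteq> 0" by simp
      show ?thesis
        unfolding a2 power_divide diff_frac_eq[OF nz(1,2)] frac_eq_eq[OF nz' nz(3)] by algebra
    qed
    moreover have "0 \<le> real k * (real n - real k) / ((real n)\<^sup>2 * (real n - 1))"
      using k n by (intro divide_nonneg_nonneg mult_nonneg_nonneg) auto
    ultimately have "?a\<^sup>2 \<le> ?q\<^sup>2" by linarith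
    then have le: "?a \<le> ?q" by (rule power2_le_imp_le) simp
    have "?q * (?q - ?a) \<le> (?q + ?a) * (?q - ?a)"
      using le a0 by (intro mult_right_mono) auto
    also have "\<dots> = real k * (real n - real k) / ((real n)\<^sup>2 * (real n - 1))"
      using d by (simp add: algebra_simps power2_eq_square)
    also have "\<dots> = ?q * ((real n - real k) / (real n * (real n - 1)))"
      using n by (simp add: power2_eq_square)
    also have "\<dots> \<le> ?q * (1 / real n)"
    proof (rule mult_left_mono)
      \<comment> \<open>Here \<open>k \<ge> 1\<close> turns \<open>n - k\<close> into at most
        \<open>n - 1\<close>, which cancels.\<close>
      have "(real n - real k) / (real n * (real n - 1)) \<le> (real n - 1) / (real n * (real n - 1))"
        using n k1 by (intro divide_right_mono) auto
      then show "(real n - real k) / (real n * (real n - 1)) \<le> 1 / real n" using n by simp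
    qed simp
    finally have "?q - ?a \<le> 1 / real n"
      by (rule mult_left_le_imp_le) (use k1 n in simp)
    with le show ?thesis by simp
  qed
  then show "0 \<le> ?q - ?a" "?q - ?a \<le> 1 / real n" by auto
qed

lemma AKR_node_in_unit:
  assumes "2 \<le> n" "k \<le> n"
  shows "AKR_node n k \<in> {0..1}"
proof -
  have "real k / real n \<le> 1" using assms by simp
  moreover have "0 \<le> AKR_node n k"
    using assms by (cases k) (auto simp: AKR_node_def)
  ultimately show ?thesis using AKR_node_bounds(1)[OF assms] by auto
qed

section \<open>Moments about the point, for the classical nodes and then for the operator\<close>

lemma bmean_scaled_moments:
  assumes "0 < n"
  shows "bmean n x (\<lambda>k. (real k / real n - x)\<^sup>2) = x * (1 - x) / real n"
    and "bmean n x (\<lambda>k. (real k / real n - x) ^ 4) =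
      (x * (1 - x) * (1 - 3 * (x * (1 - x))) + 3 * (real n - 1) * (x * (1 - x))\<^sup>2) / real n ^ 3"
proof -
  have "real k / real n - x = (real k - real n * x) / real n" for k
    using assms by (simp add: diff_divide_distrib)
  then have e: "(real k / real n - x) ^ m = (1 / real n ^ m) * (real k - real n * x) ^ m" for k m
    by (simp add: power_divide)
  show "bmean n x (\<lambda>k. (real k / real n - x)\<^sup>2) = x * (1 - x) / real n"
    unfolding e bmean_cmult bmean_central_moments using assms by (simp add: power2_eq_square)
  let ?X = "x * (1 - x)"
  have "real n * ?X * (1 - 3 * ?X) + 3 * real n * (real n - 1) * ?X\<^sup>2
      = real n * (?X * (1 - 3 * ?X) + 3 * (real n - 1) * ?X\<^sup>2)"
    by algebra
  moreover have "1 / real n ^ 4 * (real n * c) = c / real n ^ 3" for c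
    using assms by (simp add: power_numeral_reduce)
  ultimately show "bmean n x (\<lambda>k. (real k / real n - x) ^ 4) =
      (?X * (1 - 3 * ?X) + 3 * (real n - 1) * ?X\<^sup>2) / real n ^ 3"
    unfolding e bmean_cmult bmean_central_moments by (simp only:)
qed

text \<open>Comparison with the classical second moment, which is exactly
  \<open>x (1 - x) / n\<close>. The cross term is linear in \<open>k / n - x\<close>; a weighted
  AM-GM inequality reduces it to the second moment, and the scaled error is of order
  \<open>1 / sqrt n\<close>.\<close>

lemma AKR_second_moment_limit:
  assumes x: "0 \<le> x" "x \<le> 1"
  shows "(\<lambda>n. real n * bmean n x (\<lambda>k. (AKR_node n k - x)\<^sup>2)) \<longlonglongrightarrow> x * (1 - x)"
proof -
  let ?X = "x * (1 - x)"
  have bound: "norm (real n * bmean n x (\<lambda>k. (AKR_node n k - x)\<^sup>2) - ?X)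
      \<le> 1 / real n + (?X + 1) / sqrt (real n)" if n: "n \<ge> 2" for n
  proof -
    let ?s = "sqrt (real n)"
    have s: "?s > 0" "?s * ?s = real n" using n by auto
    have "\<bar>(AKR_node n k - x)\<^sup>2 - (real k / real n - x)\<^sup>2\<bar>
        \<le> 1 / (real n)\<^sup>2 + (1 / real n) * (?s * (real k / real n - x)\<^sup>2 + 1 / ?s)"
      if k: "k \<le> n" for k
    proof -
      define p e where "p = real k / real n - x" and "e = AKR_node n k - real k / real n"
      have e: "\<bar>e\<bar> \<le> 1 / real n" using AKR_node_bounds[OF n k] by (auto simp: e_def)
      \<comment> \<open>The weight \<open>sqrt n\<close> balances the two terms:
        \<open>p\<^sup>2\<close> has mean of order \<open>1 / n\<close>, so both contribute order
        \<open>1 / sqrt n\<close>.\<close>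
      have "0 \<le> (?s * \<bar>p\<bar> - 1)\<^sup>2 / ?s" using s by simp
      also have "\<dots> = ?s * p\<^sup>2 + 1 / ?s - 2 * \<bar>p\<bar>"
        using s by (simp add: field_simps power2_eq_square)
      finally have p: "2 * \<bar>p\<bar> \<le> ?s * p\<^sup>2 + 1 / ?s" by simp
      have "AKR_node n k - x = p + e" by (simp add: p_def e_def)
      then have "(AKR_node n k - x)\<^sup>2 - (real k / real n - x)\<^sup>2 = e\<^sup>2 + e * (2 * p)"
        unfolding p_def [symmetric] by (simp add: power2_sum)
      also have "\<bar>\<dots>\<bar> \<le> \<bar>e\<bar>\<^sup>2 + \<bar>e\<bar> * (2 * \<bar>p\<bar>)"
        using abs_triangle_ineq[of "e\<^sup>2" "e * (2 * p)"] by (simp add: abs_mult)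
      also have "\<dots> \<le> (1 / real n)\<^sup>2 + (1 / real n) * (?s * p\<^sup>2 + 1 / ?s)"
        using e p by (intro add_mono power_mono mult_mono) auto
      finally show ?thesis by (simp add: p_def power_divide)
    qed
    then have "\<bar>bmean n x (\<lambda>k. (AKR_node n k - x)\<^sup>2 - (real k / real n - x)\<^sup>2)\<bar>
        \<le> bmean n x (\<lambda>k. 1 / (real n)\<^sup>2 + (1 / real n) * (?s * (real k / real n - x)\<^sup>2 + 1 / ?s))"
      by (rule abs_bmean_le[OF x])
    also have "\<dots> = 1 / (real n)\<^sup>2 + (1 / real n) * (?s * (?X / real n) + 1 / ?s)"
      using n by (simp only: bmean_linear bmean_scaled_moments(1))
    finally have "\<bar>bmean n x (\<lambda>k. (AKR_node n k - x)\<^sup>2) - ?X / real n\<bar>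
        \<le> 1 / (real n)\<^sup>2 + (1 / real n) * (?s * (?X / real n) + 1 / ?s)"
      using n by (simp add: bmean_diff bmean_scaled_moments(1))
    then have "real n * \<bar>bmean n x (\<lambda>k. (AKR_node n k - x)\<^sup>2) - ?X / real n\<bar>
        \<le> real n * (1 / (real n)\<^sup>2 + (1 / real n) * (?s * (?X / real n) + 1 / ?s))"
      by (rule mult_left_mono) simp
    also have "\<dots> = 1 / real n + (?s * (?X / (?s * ?s)) + 1 / ?s)"
      using n unfolding s(2) by (simp add: field_simps power2_eq_square)
    also have "\<dots> = 1 / real n + (?X + 1) / ?s"
      using s by (simp add: field_simps del: real_sqrt_mult_self)
    also have "real n * \<bar>bmean n x (\<lambda>k. (AKR_node n k - x)\<^sup>2) - ?X / real n\<bar>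
        = norm (real n * bmean n x (\<lambda>k. (AKR_node n k - x)\<^sup>2) - ?X)"
    proof -
      have "real n * bmean n x (\<lambda>k. (AKR_node n k - x)\<^sup>2) - ?X
          = real n * (bmean n x (\<lambda>k. (AKR_node n k - x)\<^sup>2) - ?X / real n)"
        using n by (simp only: right_diff_distrib) simp
      then show ?thesis by (simp only: real_norm_def abs_mult abs_of_nat)
    qed
    finally show ?thesis .
  qed
  have "(\<lambda>n. real n * bmean n x (\<lambda>k. (AKR_node n k - x)\<^sup>2) - ?X) \<longlonglongrightarrow> 0"
  proof (rule Lim_null_comparison)
    show "\<forall>\<^sub>F n in sequentially. norm (real n * bmean n x (\<lambda>k. (AKR_node n k - x)\<^sup>2) - ?X)
        \<le> 1 / real n + (?X + 1) / sqrt (real n)"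
      using eventually_ge_at_top[of 2] by eventually_elim (rule bound)
    show "(\<lambda>n. 1 / real n + (?X + 1) / sqrt (real n)) \<longlonglongrightarrow> 0"
      by real_asymp
  qed
  then show ?thesis by (rule LIM_zero_cancel)
qed

text \<open>The squared node is \<open>k (k - 1) / (n (n - 1))\<close>, so the second factorial
  moment of the binomial distribution gives \<open>t^2\<close> back exactly. Expanding the square
  then leaves only the linear term.\<close>

lemma AKR_first_moment:
  assumes n: "2 \<le> n" and "x \<noteq> 0"
  shows "bmean n x (\<lambda>k. AKR_node n k - x) = - bmean n x (\<lambda>k. (AKR_node n k - x)\<^sup>2) / (2 * x)"
proof -
  have sq: "(AKR_node n k)\<^sup>2 = (1 / (real n * (real n - 1))) * (real k * (real k - 1))" for k
    unfolding AKR_node_def using n by (cases k) (auto intro!: real_sqrt_pow2)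
  have "bmean n x (\<lambda>k. real k * (real k - 1)) = real n * (real n - 1) * x\<^sup>2"
    unfolding bmean_def by (rule sum_kk_Bernstein)
  then have m2: "bmean n x (\<lambda>k. (AKR_node n k)\<^sup>2) = x\<^sup>2"
    unfolding sq bmean_cmult using n by simp
  have "(AKR_node n k - x)\<^sup>2 = ((AKR_node n k)\<^sup>2 - x\<^sup>2) - (2 * x) * (AKR_node n k - x)" for k
    by (simp add: power2_eq_square algebra_simps)
  then have "bmean n x (\<lambda>k. (AKR_node n k - x)\<^sup>2) = - (2 * x) * bmean n x (\<lambda>k. AKR_node n k - x)"
    by (simp only: bmean_diff [of _ _ "\<lambda>k. (AKR_node n k)\<^sup>2 - x\<^sup>2"] bmean_cmult)
      (simp add: bmean_linear m2)
  then show ?thesis using assms by simp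
qed

text \<open>Positivity of \<open>x\<close> is essential: at \<open>x = 0\<close> all mass lies on
  the node 0 and the limit would be 0 instead of \<open>-1/2\<close>.\<close>

lemma AKR_first_moment_limit:
  assumes x: "0 < x" "x \<le> 1"
  shows "(\<lambda>n. real n * bmean n x (\<lambda>k. AKR_node n k - x)) \<longlonglongrightarrow> - ((1 - x) / 2)"
proof -
  have "(\<lambda>n. - (1 / (2 * x)) * (real n * bmean n x (\<lambda>k. (AKR_node n k - x)\<^sup>2)))
      \<longlonglongrightarrow> - (1 / (2 * x)) * (x * (1 - x))"
    using x by (intro tendsto_mult tendsto_const AKR_second_moment_limit) auto
  moreover have "\<forall>\<^sub>F n in sequentially.
      - (1 / (2 * x)) * (real n * bmean n x (\<lambda>k. (AKR_node n k - x)\<^sup>2))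
      = real n * bmean n x (\<lambda>k. AKR_node n k - x)"
    using eventually_ge_at_top[of 2]
    by eventually_elim (use x in \<open>simp add: AKR_first_moment\<close>)
  moreover have "- (1 / (2 * x)) * (x * (1 - x)) = - ((1 - x) / 2)"
    using x by simp
  ultimately show ?thesis
    by (simp only: Lim_transform_eventually)
qed

text \<open>Applying \<open>(u + v)\<^sup>2 \<le> 2 (u\<^sup>2 + v\<^sup>2)\<close> twice gives the
  factor 8. The classical fourth moment is of order \<open>1 / n^2\<close> and the node shift
  contributes at most \<open>8 / n^4\<close>, so both vanish after scaling by
  \<open>n\<close>.\<close>

lemma AKR_fourth_moment_limit:
  assumes x: "0 \<le> x" "x \<le> 1"
  shows "(\<lambda>n. real n * bmean n x (\<lambda>k. (AKR_node n k - x) ^ 4)) \<longlonglongrightarrow> 0"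
proof -
  let ?X = "x * (1 - x)"
  let ?c = "\<lambda>n. 8 * ((?X * (1 - 3 * ?X) + 3 * (real n - 1) * ?X\<^sup>2) / real n ^ 3) + 8 / real n ^ 4"
  have bound: "norm (real n * bmean n x (\<lambda>k. (AKR_node n k - x) ^ 4)) \<le> real n * ?c n"
    if n: "n \<ge> 2" for n
  proof -
    have "\<bar>(AKR_node n k - x) ^ 4\<bar> \<le> 8 * (real k / real n - x) ^ 4 + 8 / real n ^ 4"
      if k: "k \<le> n" for k
    proof -
      define p e where "p = real k / real n - x" and "e = AKR_node n k - real k / real n"
      have "\<bar>e\<bar> \<le> 1 / real n" using AKR_node_bounds[OF n k] by (auto simp: e_def)
      then have "\<bar>e\<bar> ^ 4 \<le> (1 / real n) ^ 4" by (intro power_mono) auto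
      then have e: "e ^ 4 \<le> 1 / real n ^ 4" by (simp add: power_divide)
      have sq: "(u + v)\<^sup>2 \<le> 2 * (u\<^sup>2 + v\<^sup>2)" for u v :: real
        using sum_squares_bound[of u v] by (simp add: power2_sum)
      have "(p + e) ^ 4 = ((p + e)\<^sup>2)\<^sup>2" by simp
      also have "\<dots> \<le> (2 * (p\<^sup>2 + e\<^sup>2))\<^sup>2" using sq by (intro power_mono) auto
      also have "\<dots> = 4 * (p\<^sup>2 + e\<^sup>2)\<^sup>2" by (simp only: power_mult_distrib) simp
      also have "\<dots> \<le> 4 * (2 * ((p\<^sup>2)\<^sup>2 + (e\<^sup>2)\<^sup>2))" by (intro mult_left_mono sq) simp
      also have "\<dots> = 8 * p ^ 4 + 8 * e ^ 4" by simp
      also have "\<dots> \<le> 8 * p ^ 4 + 8 / real n ^ 4" using e by simp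
      finally show ?thesis by (simp add: p_def e_def)
    qed
    then have "\<bar>bmean n x (\<lambda>k. (AKR_node n k - x) ^ 4)\<bar>
        \<le> bmean n x (\<lambda>k. 8 * (real k / real n - x) ^ 4 + 8 / real n ^ 4)"
      by (rule abs_bmean_le[OF x])
    also have "\<dots> = ?c n"
      using n by (simp only: bmean_linear bmean_scaled_moments(2))
    finally have "\<bar>bmean n x (\<lambda>k. (AKR_node n k - x) ^ 4)\<bar> \<le> ?c n" .
    then show ?thesis by (simp add: abs_mult mult_left_mono)
  qed
  show ?thesis
  proof (rule Lim_null_comparison)
    show "\<forall>\<^sub>F n in sequentially.
        norm (real n * bmean n x (\<lambda>k. (AKR_node n k - x) ^ 4)) \<le> real n * ?c n"
      using eventually_ge_at_top[of 2] by eventually_elim (rule bound)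
    show "(\<lambda>n. real n * ?c n) \<longlonglongrightarrow> 0"
      by real_asymp
  qed
qed

section \<open>Approximation and the uniform Voronovskaya limit\<close>

text \<open>Near the diagonal uniform continuity gives \<epsilon>; at distance at least \<delta> the
  bound \<open>2 * M\<close> is absorbed by \<open>2 * M / \<delta>\<^sup>2\<close> times the
  squared distance. The result can be averaged by \<open>bmean\<close> directly, and
  \<open>C\<close> does not depend on \<open>s\<close>.\<close>

lemma continuous_quadratic_modulus:
  fixes G :: "real \<times> real \<Rightarrow> real"
  assumes "continuous_on unit_square G" "0 < \<epsilon>"
  obtains C where "0 \<le> C"
    "\<And>s t t'. \<lbrakk>s \<in> {0..1}; t \<in> {0..1}; t' \<in> {0..1}\<rbrakk> \<Longrightarrow>
      \<bar>G (s, t) - G (s, t')\<bar> \<le> \<epsilon> + C * (t - t')\<^sup>2"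
proof -
  have cpt: "compact unit_square" by (intro compact_Times compact_Icc)
  have "uniformly_continuous_on unit_square G"
    using assms cpt by (intro compact_uniformly_continuous)
  from this [unfolded uniformly_continuous_on_def, rule_format, OF \<open>0 < \<epsilon>\<close>]
  obtain \<delta> where \<delta>: "0 < \<delta>" "\<And>p p'. \<lbrakk>p \<in> unit_square; p' \<in> unit_square; dist p' p < \<delta>\<rbrakk>
      \<Longrightarrow> dist (G p') (G p) < \<epsilon>"
    by (auto simp del: split_paired_All)
  have "bounded (G ` unit_square)"
    using assms cpt by (intro compact_imp_bounded compact_continuous_image)
  then obtain M where M: "0 < M" "\<And>p. p \<in> unit_square \<Longrightarrow> \<bar>G p\<bar> \<le> M"
    unfolding bounded_pos by auto
  show thesis
  proof
    show "0 \<le> 2 * M / \<delta>\<^sup>2" using M by simp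
    fix s t t' :: real
    assume st: "s \<in> {0..1}" "t \<in> {0..1}" "t' \<in> {0..1}"
    show "\<bar>G (s, t) - G (s, t')\<bar> \<le> \<epsilon> + 2 * M / \<delta>\<^sup>2 * (t - t')\<^sup>2"
    proof (cases "\<bar>t - t'\<bar> < \<delta>")
      case True
      then have "\<bar>G (s, t) - G (s, t')\<bar> < \<epsilon>"
        using \<delta>(2)[of "(s, t')" "(s, t)"] st by (simp add: dist_Pair_Pair dist_real_def)
      moreover have "0 \<le> 2 * M / \<delta>\<^sup>2 * (t - t')\<^sup>2" using M by simp
      ultimately show ?thesis by linarith
    next
      case False
      then have "\<delta>\<^sup>2 \<le> (t - t')\<^sup>2"
        using \<delta>(1) power_mono[of \<delta> "\<bar>t - t'\<bar>" 2] by simp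
      then have "2 * M * 1 \<le> 2 * M * ((t - t')\<^sup>2 / \<delta>\<^sup>2)"
        using M \<delta>(1) by (intro mult_left_mono) auto
      moreover have "\<bar>G (s, t) - G (s, t')\<bar> \<le> 2 * M"
        using M(2)[of "(s, t)"] M(2)[of "(s, t')"] st by auto
      ultimately show ?thesis using \<open>0 < \<epsilon>\<close> by simp
    qed
  qed
qed

section \<open>Pointwise convergence on continuous functions, then the uniform Voronovskaya
  limit\<close>

lemma AKR_second_moment_null:
  assumes x: "0 \<le> x" "x \<le> 1"
  shows "(\<lambda>n. bmean n x (\<lambda>k. (AKR_node n k - x)\<^sup>2)) \<longlonglongrightarrow> 0"
proof -
  have "(\<lambda>n. (1 / real n) * (real n * bmean n x (\<lambda>k. (AKR_node n k - x)\<^sup>2))) \<longlonglongrightarrow> 0 * (x * (1 - x))"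
    by (intro tendsto_mult AKR_second_moment_limit x lim_1_over_n)
  then have "(\<lambda>n. (1 / real n) * (real n * bmean n x (\<lambda>k. (AKR_node n k - x)\<^sup>2))) \<longlonglongrightarrow> 0"
    by (simp only: mult_zero_left)
  moreover have "\<forall>\<^sub>F n in sequentially. (1 / real n) * (real n * bmean n x (\<lambda>k. (AKR_node n k - x)\<^sup>2))
      = bmean n x (\<lambda>k. (AKR_node n k - x)\<^sup>2)"
    using eventually_gt_at_top[of 0] by eventually_elim simp
  ultimately show ?thesis by (rule Lim_transform_eventually)
qed

text \<open>Korovkin's argument: a quadratic modulus at \<open>x\<close> together with a vanishing
  second moment.\<close>

lemma AKR_tendsto:
  assumes x: "0 \<le> x" "x \<le> 1" and g: "continuous_on {0..1} g"
  shows "(\<lambda>n. bmean n x (\<lambda>k. g (AKR_node n k))) \<longlonglongrightarrow> g x"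
proof (rule tendstoI)
  fix \<epsilon> :: real assume "0 < \<epsilon>"
  \<comment> \<open>A function of one variable is read as one on the square that ignores the first
    coordinate.\<close>
  have cont: "continuous_on unit_square (\<lambda>p. g (snd p))"
    by (intro continuous_on_compose2[OF g] continuous_intros) auto
  have "0 < \<epsilon> / 2" using \<open>0 < \<epsilon>\<close> by simp
  then obtain C where "\<And>s t t'. \<lbrakk>s \<in> {0..1}; t \<in> {0..1}; t' \<in> {0..1}\<rbrakk> \<Longrightarrow>
      \<bar>g (snd (s :: real, t)) - g (snd (s, t'))\<bar> \<le> \<epsilon> / 2 + C * (t - t')\<^sup>2"
    by (rule continuous_quadratic_modulus[OF cont]) (rule that)
  from this[of 0 _ x] x have C: "\<bar>g t - g x\<bar> \<le> \<epsilon> / 2 + C * (t - x)\<^sup>2" if "t \<in> {0..1}" for t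
    using that by simp
  have "(\<lambda>n. \<epsilon> / 2 + C * bmean n x (\<lambda>k. (AKR_node n k - x)\<^sup>2)) \<longlonglongrightarrow> \<epsilon> / 2 + C * 0"
    by (intro tendsto_intros AKR_second_moment_null x)
  then have "\<forall>\<^sub>F n in sequentially. \<epsilon> / 2 + C * bmean n x (\<lambda>k. (AKR_node n k - x)\<^sup>2) < \<epsilon>"
    by (rule order_tendstoD) (use \<open>0 < \<epsilon>\<close> in simp)
  then show "\<forall>\<^sub>F n in sequentially. dist (bmean n x (\<lambda>k. g (AKR_node n k))) (g x) < \<epsilon>"
    using eventually_ge_at_top[of 2]
  proof eventually_elim
    case (elim n)
    have "\<bar>bmean n x (\<lambda>k. g (AKR_node n k) - g x)\<bar>
        \<le> bmean n x (\<lambda>k. \<epsilon> / 2 + C * (AKR_node n k - x)\<^sup>2)"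
      by (intro abs_bmean_le x C AKR_node_in_unit elim(2))
    with elim(1) show ?case by (simp add: bmean_linear dist_real_def)
  qed
qed

text \<open>The remainder is governed by the oscillation of \<open>ddh s\<close> between
  \<open>y\<close> and \<open>t\<close>, to which the quadratic modulus applies; hence
  \<open>C\<close> is uniform in \<open>s\<close>, and a fourth power appears.\<close>

lemma uniform_second_order_Taylor:
  fixes h dh ddh :: "real \<Rightarrow> real \<Rightarrow> real"
  assumes h: "\<And>s t. \<lbrakk>s \<in> {0..1}; t \<in> {0..1}\<rbrakk> \<Longrightarrow>
      (h s has_real_derivative dh s t) (at t within {0..1})"
    and dh: "\<And>s t. \<lbrakk>s \<in> {0..1}; t \<in> {0..1}\<rbrakk> \<Longrightarrow>
      (dh s has_real_derivative ddh s t) (at t within {0..1})"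
    and ddh: "continuous_on unit_square (\<lambda>(s, t). ddh s t)"
    and y: "y \<in> {0..1}" and "0 < \<epsilon>"
  obtains C where "0 \<le> C"
    "\<And>s t. \<lbrakk>s \<in> {0..1}; t \<in> {0..1}\<rbrakk> \<Longrightarrow>
      \<bar>h s t - h s y - dh s y * (t - y) - ddh s y / 2 * (t - y)\<^sup>2\<bar>
        \<le> \<epsilon> * (t - y)\<^sup>2 + C * (t - y) ^ 4"
proof -
  obtain C where C: "0 \<le> C" "\<And>s t t'. \<lbrakk>s \<in> {0..1}; t \<in> {0..1}; t' \<in> {0..1}\<rbrakk> \<Longrightarrow>
      \<bar>ddh s t - ddh s t'\<bar> \<le> \<epsilon> + C * (t - t')\<^sup>2"
    using continuous_quadratic_modulus[OF ddh \<open>0 < \<epsilon>\<close>] by (metis case_prod_conv)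
  show thesis
  proof
    show "0 \<le> C" by fact
    fix s t :: real assume s: "s \<in> {0..1}" and t: "t \<in> {0..1}"
    let ?S = "closed_segment y t"
    have sub: "?S \<subseteq> {0..1}" using y t by (intro closed_segment_subset) auto
    \<comment> \<open>The quadratic term is subtracted beforehand, so a first-order Taylor estimate
      suffices: \<open>F 2\<close> is the increment of \<open>ddh s\<close>, while
      \<open>F 0\<close> and \<open>F 1\<close> keep their values at \<open>y\<close>.\<close>
    define F where "F i = (if i = 0 then (\<lambda>u. h s u - ddh s y / 2 * (u - y)\<^sup>2)
        else if i = 1 then (\<lambda>u. dh s u - ddh s y * (u - y)) else (\<lambda>u. ddh s u - ddh s y))" for i :: nat
    have "norm (F 0 t - (\<Sum>i\<le>1. F i y * (t - y) ^ i / fact i))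
        \<le> (\<epsilon> + C * (t - y)\<^sup>2) * norm (t - y) ^ Suc 1 / fact 1"
    proof (rule field_Taylor[where S = ?S])
      fix i u assume u: "u \<in> ?S" and "i \<le> (1::nat)"
      then have u01: "u \<in> {0..1}" using sub by auto
      note d = DERIV_subset[OF h[OF s u01] sub] DERIV_subset[OF dh[OF s u01] sub]
      from \<open>i \<le> 1\<close> consider "i = 0" | "i = 1" by linarith
      then show "(F i has_field_derivative F (Suc i) u) (at u within ?S)"
        by cases (auto simp: F_def intro!: derivative_eq_intros d)
    next
      fix u assume u: "u \<in> ?S"
      then have u01: "u \<in> {0..1}" using sub by auto
      have "\<bar>u - y\<bar> \<le> \<bar>t - y\<bar>" using u by (auto simp: closed_segment_eq_real_ivl split: if_splits)
      then have "(u - y)\<^sup>2 \<le> (t - y)\<^sup>2" by (simp add: abs_le_square_iff)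
      then have "C * (u - y)\<^sup>2 \<le> C * (t - y)\<^sup>2" using C(1) by (rule mult_left_mono)
      then show "norm (F (Suc 1) u) \<le> \<epsilon> + C * (t - y)\<^sup>2"
        using C(2)[OF s u01 y] by (simp add: F_def)
    qed auto
    also have "\<dots> = \<epsilon> * (t - y)\<^sup>2 + C * ((t - y)\<^sup>2 * (t - y)\<^sup>2)"
      by (simp add: distrib_right mult.assoc flip: power2_eq_square)
    also have "(t - y)\<^sup>2 * (t - y)\<^sup>2 = (t - y) ^ 4"
      by (simp flip: power_add)
    also have "(\<Sum>i\<le>1. F i y * (t - y) ^ i / fact i) = h s y + dh s y * (t - y)"
      by (simp add: F_def)
    also have "F 0 t = h s t - ddh s y / 2 * (t - y)\<^sup>2"
      by (simp add: F_def)
    finally show "\<bar>h s t - h s y - dh s y * (t - y) - ddh s y / 2 * (t - y)\<^sup>2\<bar>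
        \<le> \<epsilon> * (t - y)\<^sup>2 + C * (t - y) ^ 4"
      by (simp only: real_norm_def diff_diff_eq add_ac)
  qed
qed

text \<open>After Taylor expansion \<open>s\<close> enters the main terms only through
  \<open>dh s y\<close> and \<open>ddh s y\<close>, which are bounded on a compact set. The moment
  limits, free of \<open>s\<close>, then give uniformity.\<close>

lemma AKR_uniform_Voronovskaya:
  fixes h dh ddh :: "real \<Rightarrow> real \<Rightarrow> real"
  assumes h: "\<And>s t. \<lbrakk>s \<in> {0..1}; t \<in> {0..1}\<rbrakk> \<Longrightarrow>
      (h s has_real_derivative dh s t) (at t within {0..1})"
    and dh: "\<And>s t. \<lbrakk>s \<in> {0..1}; t \<in> {0..1}\<rbrakk> \<Longrightarrow>
      (dh s has_real_derivative ddh s t) (at t within {0..1})"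
    and c1: "continuous_on unit_square (\<lambda>(s, t). dh s t)"
    and c2: "continuous_on unit_square (\<lambda>(s, t). ddh s t)"
    and y: "0 < y" "y \<le> 1"
  shows "uniform_limit {0..1} (\<lambda>n s. real n * (bmean n y (\<lambda>k. h s (AKR_node n k)) - h s y))
    (\<lambda>s. y * (1 - y) / 2 * ddh s y - (1 - y) / 2 * dh s y) sequentially"
proof (rule uniform_limitI)
  fix \<epsilon> :: real assume \<epsilon>: "0 < \<epsilon>"
  have y01: "y \<in> {0..1}" using y by simp
  have bdd: "\<exists>M. \<forall>s\<in>{0..1}. \<bar>g s y\<bar> \<le> M"
    if "continuous_on unit_square (\<lambda>(s, t). g s t)" for g :: "real \<Rightarrow> real \<Rightarrow> real"
  proof -
    have "bounded ((\<lambda>(s, t). g s t) ` unit_square)"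
      using that by (intro compact_imp_bounded compact_continuous_image compact_Times compact_Icc)
    then obtain M where M: "\<forall>z \<in> (\<lambda>(s, t). g s t) ` unit_square. norm z \<le> M"
      unfolding bounded_iff by blast
    have "\<bar>g s y\<bar> \<le> M" if "s \<in> {0..1}" for s
      using bspec[OF M imageI, of "(s, y)"] that y01 by simp
    then show ?thesis by blast
  qed
  obtain M1 M2 where M: "\<And>s. s \<in> {0..1} \<Longrightarrow> \<bar>dh s y\<bar> \<le> M1" "\<And>s. s \<in> {0..1} \<Longrightarrow> \<bar>ddh s y\<bar> \<le> M2"
    using bdd[OF c1] bdd[OF c2] by blast
  obtain C where C: "0 \<le> C" "\<And>s t. \<lbrakk>s \<in> {0..1}; t \<in> {0..1}\<rbrakk> \<Longrightarrow>
      \<bar>h s t - h s y - dh s y * (t - y) - ddh s y / 2 * (t - y)\<^sup>2\<bar> \<le> \<epsilon> * (t - y)\<^sup>2 + C * (t - y) ^ 4"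
    using uniform_second_order_Taylor[OF h dh c2 y01 \<epsilon>] by blast
  define m1 m2 m4 where "m1 n = real n * bmean n y (\<lambda>k. AKR_node n k - y)"
    and "m2 n = real n * bmean n y (\<lambda>k. (AKR_node n k - y)\<^sup>2)"
    and "m4 n = real n * bmean n y (\<lambda>k. (AKR_node n k - y) ^ 4)" for n
  have m: "m1 \<longlonglongrightarrow> - ((1 - y) / 2)" "m2 \<longlonglongrightarrow> y * (1 - y)" "m4 \<longlonglongrightarrow> 0"
    unfolding m1_def m2_def m4_def
    using y by (auto intro!: AKR_first_moment_limit AKR_second_moment_limit AKR_fourth_moment_limit)
  \<comment> \<open>A bound for the error at every \<open>s\<close> at once: the first two summands
    come from the moments not having reached their limits, the last from the Taylor
    remainder.\<close>
  define D where "D n = M1 * \<bar>m1 n + (1 - y) / 2\<bar> + M2 / 2 * \<bar>m2 n - y * (1 - y)\<bar>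
      + (\<epsilon> * m2 n + C * m4 n)" for n
  \<comment> \<open>\<open>D\<close> tends to \<open>\<epsilon> * (y * (1 - y))\<close>, which is
    already below \<epsilon>, so \<epsilon> needs no prior rescaling.\<close>
  have "y * (1 - y) < 1"
    using mult_right_mono[of y 1 "1 - y"] y by simp
  then have "\<epsilon> * (y * (1 - y)) < \<epsilon> * 1"
    using \<epsilon> by (rule mult_strict_left_mono)
  moreover have lim: "D \<longlonglongrightarrow> M1 * \<bar>- ((1 - y) / 2) + (1 - y) / 2\<bar> + M2 / 2 * \<bar>y * (1 - y) - y * (1 - y)\<bar>
      + (\<epsilon> * (y * (1 - y)) + C * 0)"
    unfolding D_def by (intro tendsto_intros m)
  ultimately have "\<forall>\<^sub>F n in sequentially. D n < \<epsilon>"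
    by (intro order_tendstoD(2)[OF lim]) simp
  then show "\<forall>\<^sub>F n in sequentially. \<forall>s\<in>{0..1}.
      dist (real n * (bmean n y (\<lambda>k. h s (AKR_node n k)) - h s y))
        (y * (1 - y) / 2 * ddh s y - (1 - y) / 2 * dh s y) < \<epsilon>"
    using eventually_ge_at_top[of 2]
  proof eventually_elim
    case (elim n)
    show ?case
    proof
      fix s :: real assume s: "s \<in> {0..1}"
      let ?a = "AKR_node n"
      let ?R = "\<lambda>t. h s t - h s y - dh s y * (t - y) - ddh s y / 2 * (t - y)\<^sup>2"
      have "\<bar>bmean n y (\<lambda>k. ?R (?a k))\<bar> \<le> bmean n y (\<lambda>k. \<epsilon> * (?a k - y)\<^sup>2 + C * (?a k - y) ^ 4)"
        using C(2)[OF s] AKR_node_in_unit[OF elim(2)] y by (intro abs_bmean_le) auto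
      then have "real n * \<bar>bmean n y (\<lambda>k. ?R (?a k))\<bar>
          \<le> real n * bmean n y (\<lambda>k. \<epsilon> * (?a k - y)\<^sup>2 + C * (?a k - y) ^ 4)"
        by (rule mult_left_mono) simp
      also have "\<dots> = \<epsilon> * m2 n + C * m4 n"
        unfolding m2_def m4_def bmean_add bmean_cmult by (simp add: algebra_simps)
      finally have R: "\<bar>real n * bmean n y (\<lambda>k. ?R (?a k))\<bar> \<le> \<epsilon> * m2 n + C * m4 n"
        by (simp add: abs_mult)
      have lin: "bmean n y (\<lambda>k. ?R (?a k)) = bmean n y (\<lambda>k. h s (?a k)) - h s y
          - dh s y * bmean n y (\<lambda>k. ?a k - y) - ddh s y / 2 * bmean n y (\<lambda>k. (?a k - y)\<^sup>2)"
        \<comment> \<open>The explicit instances fix how the nested difference is split, one level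
          at a time.\<close>
        by (simp only: bmean_diff [of _ _ "\<lambda>k. h s (?a k) - h s y - dh s y * (?a k - y)"]
          bmean_diff [of _ _ "\<lambda>k. h s (?a k) - h s y"] bmean_diff [of _ _ "\<lambda>k. h s (?a k)"]
          bmean_cmult bmean_const)
      \<comment> \<open>Pure algebra separating the two moment errors, weighted by the derivatives
        \<open>p\<close> and \<open>q\<close>, from the scaled Taylor remainder.\<close>
      have regroup: "N * (B - H) - (Y / 2 * q - c / 2 * p)
          = p * (N * b1 + c / 2) + q / 2 * (N * b2 - Y) + N * (B - H - p * b1 - q / 2 * b2)"
        for N B H Y q p c b1 b2 :: real
        by (simp add: field_simps)
      have eq: "real n * (bmean n y (\<lambda>k. h s (?a k)) - h s y)
          - (y * (1 - y) / 2 * ddh s y - (1 - y) / 2 * dh s y)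
          = dh s y * (m1 n + (1 - y) / 2) + ddh s y / 2 * (m2 n - y * (1 - y))
          + real n * bmean n y (\<lambda>k. ?R (?a k))"
        unfolding lin m1_def m2_def by (rule regroup)
      have "\<bar>a + b + c\<bar> \<le> \<bar>a\<bar> + \<bar>b\<bar> + \<bar>c\<bar>" for a b c :: real by linarith
      from this[of "dh s y * (m1 n + (1 - y) / 2)" "ddh s y / 2 * (m2 n - y * (1 - y))"
        "real n * bmean n y (\<lambda>k. ?R (?a k))"]
      have "dist (real n * (bmean n y (\<lambda>k. h s (?a k)) - h s y))
          (y * (1 - y) / 2 * ddh s y - (1 - y) / 2 * dh s y)
          \<le> \<bar>dh s y\<bar> * \<bar>m1 n + (1 - y) / 2\<bar> + \<bar>ddh s y\<bar> / 2 * \<bar>m2 n - y * (1 - y)\<bar>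
          + \<bar>real n * bmean n y (\<lambda>k. ?R (?a k))\<bar>"
        by (simp only: dist_real_def eq abs_mult abs_divide abs_numeral)
      also have "\<dots> \<le> D n"
        unfolding D_def using M[OF s] R by (intro add_mono mult_right_mono) simp_all
      finally show "dist (real n * (bmean n y (\<lambda>k. h s (?a k)) - h s y))
          (y * (1 - y) / 2 * ddh s y - (1 - y) / 2 * dh s y) < \<epsilon>"
        using elim(1) by (rule order.strict_trans1)
    qed
  qed
qed

section \<open>The bivariate operator\<close>

lemma AKR2_iterated:
  "AKR2 n f (x, y) = bmean n x (\<lambda>k. bmean n y (\<lambda>l. f (AKR_node n k, AKR_node n l)))"
  by (simp add: AKR2_def bmean_def atMost_atLeast0 sum_distrib_left mult_ac)

lemma partial_x_has_derivative:
  assumes "has_partials_on_square f" "s \<in> {0..1}" "t \<in> {0..1}"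
  shows "((\<lambda>s. f (s, t)) has_real_derivative partial_x f (s, t)) (at s within {0..1})"
  using assms
  by (auto simp: has_partials_on_square_def partial_x_def has_real_derivative_iff_has_vector_derivative
    vector_derivative_works [symmetric])

lemma partial_y_has_derivative:
  assumes "has_partials_on_square f" "s \<in> {0..1}" "t \<in> {0..1}"
  shows "((\<lambda>t. f (s, t)) has_real_derivative partial_y f (s, t)) (at t within {0..1})"
  using assms
  by (auto simp: has_partials_on_square_def partial_y_def has_real_derivative_iff_has_vector_derivative
    vector_derivative_works [symmetric])

theorem theorem2p1:
  fixes f :: "real \<times> real \<Rightarrow> real" and x y :: real
  assumes "0 < x" "x \<le> 1" "0 < y" "y \<le> 1"
    and "Ck_square 2 f"
  shows "(\<lambda>n. real n * (AKR2 n f (x, y) - f (x, y))) \<longlonglongrightarrow>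
      x * (1 - x) / 2 * partial_x (partial_x f) (x, y)
    + y * (1 - y) / 2 * partial_y (partial_y f) (x, y)
    - (1 - x) / 2 * partial_x f (x, y)
    - (1 - y) / 2 * partial_y f (x, y)"
proof -
  let ?fx = "partial_x f" and ?fy = "partial_y f"
  let ?fxx = "partial_x ?fx" and ?fyy = "partial_y ?fy"
  let ?a = AKR_node
  note xy = assms(1-4)
  have partials: "has_partials_on_square f" "has_partials_on_square ?fx" "has_partials_on_square ?fy"
    and cont: "continuous_on unit_square ?fx" "continuous_on unit_square ?fy"
      "continuous_on unit_square ?fxx" "continuous_on unit_square ?fyy"
    using \<open>Ck_square 2 f\<close> by (auto simp: numeral_2_eq_2)
  have slice: "continuous_on unit_square (\<lambda>(s, t). g (t, y))"
    if "continuous_on unit_square g" for g :: "real \<times> real \<Rightarrow> real"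
    unfolding case_prod_unfold using xy
    by (intro continuous_on_compose2[OF that] continuous_intros) auto
  \<comment> \<open>In the x direction the family is constant in its parameter; evaluating at
    parameter 0 then gives the ordinary limit.\<close>
  have "uniform_limit {0..1 :: real} (\<lambda>n s. real n * (bmean n x (\<lambda>k. f (?a n k, y)) - f (x, y)))
      (\<lambda>s. x * (1 - x) / 2 * ?fxx (x, y) - (1 - x) / 2 * ?fx (x, y)) sequentially"
    by (rule AKR_uniform_Voronovskaya[where h = "\<lambda>s t. f (t, y)" and dh = "\<lambda>s t. ?fx (t, y)"
          and ddh = "\<lambda>s t. ?fxx (t, y)"])
      (use xy in \<open>auto intro: partial_x_has_derivative partials slice[OF cont(1)] slice[OF cont(3)]
        simp del: split_paired_All\<close>)
  then have first: "(\<lambda>n. real n * (bmean n x (\<lambda>k. f (?a n k, y)) - f (x, y))) \<longlonglongrightarrow>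
      x * (1 - x) / 2 * ?fxx (x, y) - (1 - x) / 2 * ?fx (x, y)"
    by (rule tendsto_uniform_limitI[where x = 0]) simp
  \<comment> \<open>\<open>G n s\<close> is the scaled error in the second variable along the line
    with abscissa \<open>s\<close>, and \<open>L s\<close> is its uniform limit.\<close>
  define G where "G n s = real n * (bmean n y (\<lambda>l. f (s, ?a n l)) - f (s, y))" for n s
  define L where "L s = y * (1 - y) / 2 * ?fyy (s, y) - (1 - y) / 2 * ?fy (s, y)" for s
  have GL: "uniform_limit {0..1} G L sequentially"
    unfolding G_def L_def
    by (rule AKR_uniform_Voronovskaya[where h = "\<lambda>s t. f (s, t)" and dh = "\<lambda>s t. ?fy (s, t)"
          and ddh = "\<lambda>s t. ?fyy (s, t)"])
      (use xy in \<open>auto intro: partial_y_has_derivative partials cont\<close>)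
  have "continuous_on {0..1} L"
    unfolding L_def using xy
    by (intro continuous_intros continuous_on_compose2[OF cont(2)] continuous_on_compose2[OF cont(4)]) auto
  then have L: "(\<lambda>n. bmean n x (\<lambda>k. L (?a n k))) \<longlonglongrightarrow> L x"
    using xy by (intro AKR_tendsto) auto
  have "(\<lambda>n. bmean n x (\<lambda>k. G n (?a n k)) - bmean n x (\<lambda>k. L (?a n k))) \<longlonglongrightarrow> 0"
  proof (rule tendstoI)
    fix \<epsilon> :: real assume "0 < \<epsilon>"
    then have "\<forall>\<^sub>F n in sequentially. \<forall>s\<in>{0..1}. dist (G n s) (L s) < \<epsilon> / 2"
      using GL by (intro uniform_limitD) auto
    then show "\<forall>\<^sub>F n in sequentially.
        dist (bmean n x (\<lambda>k. G n (?a n k)) - bmean n x (\<lambda>k. L (?a n k))) 0 < \<epsilon>"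
      using eventually_ge_at_top[of 2]
    proof eventually_elim
      case (elim n)
      \<comment> \<open>Uniformity is what counts here: \<open>G n\<close> is evaluated at nodes
        that move with \<open>n\<close>. All of them lie in the unit interval, and the mean has
        total mass one.\<close>
      have "\<bar>G n (?a n k) - L (?a n k)\<bar> \<le> \<epsilon> / 2" if "k \<le> n" for k
        using elim(1) AKR_node_in_unit[OF elim(2) that] by (auto simp: dist_real_def less_imp_le)
      then have "\<bar>bmean n x (\<lambda>k. G n (?a n k) - L (?a n k))\<bar> \<le> bmean n x (\<lambda>k. \<epsilon> / 2)"
        using xy by (intro abs_bmean_le) auto
      then show ?case using \<open>0 < \<epsilon>\<close> by (simp add: bmean_diff bmean_const)
    qed
  qed
  from tendsto_add[OF this L] have "(\<lambda>n. bmean n x (\<lambda>k. G n (?a n k))) \<longlonglongrightarrow> L x" by simp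
  from tendsto_add[OF first this]
  have "(\<lambda>n. real n * (bmean n x (\<lambda>k. f (?a n k, y)) - f (x, y)) + bmean n x (\<lambda>k. G n (?a n k))) \<longlonglongrightarrow>
      x * (1 - x) / 2 * ?fxx (x, y) - (1 - x) / 2 * ?fx (x, y) + L x" .
  \<comment> \<open>The intermediate values \<open>f (?a n k, y)\<close> cancel, leaving the
    bivariate error.\<close>
  moreover have "real n * (bmean n x (\<lambda>k. f (?a n k, y)) - f (x, y)) + bmean n x (\<lambda>k. G n (?a n k))
      = real n * (AKR2 n f (x, y) - f (x, y))" for n
    unfolding G_def AKR2_iterated bmean_cmult bmean_diff by (simp add: algebra_simps)
  ultimately show ?thesis by (simp add: L_def algebra_simps)
qed

end
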